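(* Let $\mathcal{K}$ be a Mercer kernel on a set of objects $\mathcal{X}$ with induced metric $d_\mathcal{K}(x,y)=\sqrt{\mathcal{K}(x,x)+\mathcal{K}(y,y)-2\mathcal{K}(x,y)}$, let $S\subseteq\mathcal{X}$ be finite, let $T$ be a cover tree on $S$ with respect to $d_\mathcal{K}$, and let $q\in\mathcal{X}$ with $\mathcal{K}(q,q)<\infty$. Then the algorithm FastMKS$(T,q)$ returns an element of $\arg\max_{r\in S}\mathcal{K}(q,r)$.
   Context: A cover tree on a finite set $S$ with respect to a metric $d$ is a leveled tree with levels $C_i\subseteq S$ indexed by integers $i$ (decreasing as the tree is descended), where $C_\infty$ consists of a single point (the root) and $C_{-\infty}=S$, satisfying for all $i$: (nesting) $C_i\subseteq C_{i-1}$; (covering) for every $p\in C_{i-1}$ there is $q\in C_i$ with $d(p,q)\le 2^i$, and exactly one such $q$ is the parent of $p$; (separation) for all distinct $p,q\in C_i$, $d(p,q)>2^i$. The children of $r\in C_i$ are the points of $C_{i-1}$ whose parent is $r$ (including $r$ itself). For a finite set $R$, write $\mathcal{K}(q,R)=\max_{r\in R}\mathcal{K}(q,r)$. Algorithm FastMKS$(T,q)$: set $R_\infty=C_\infty$; for $i$ from $\infty$ down to $-\infty$, let $R=\{\text{children of } r : r\in R_i\}$ and $R_{i-1}=\{r\in R:\mathcal{K}(q,r)\ge\mathcal{K}(q,R)-2^i\sqrt{\mathcal{K}(q,q)}\}$; finally return $\arg\max_{r\in R_{-\infty}}\mathcal{K}(q,r)$. *)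

theory Defs
  imports Complex_Main "HOL-Library.Extended"
begin

definition mercer_kernel :: "'a set \<Rightarrow> ('a \<Rightarrow> 'a \<Rightarrow> real) \<Rightarrow> bool" where
  "mercer_kernel X K \<longleftrightarrow>
     (\<forall>x\<in>X. \<forall>y\<in>X. K x y = K y x) \<and>
     (\<forall>F c. finite F \<and> F \<subseteq> X \<longrightarrow> 0 \<le> (\<Sum>x\<in>F. \<Sum>y\<in>F. c x * c y * K x y))"

definition kernel_dist :: "('a \<Rightarrow> 'a \<Rightarrow> real) \<Rightarrow> 'a \<Rightarrow> 'a \<Rightarrow> real" where
  "kernel_dist K x y = sqrt (K x x + K y y - 2 * K x y)"

(* parent T i p is the parent, in level i, of the point p of level i - 1. *)
record 'a leveled_tree =
  level :: "int extended \<Rightarrow> 'a set"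
  parent :: "int \<Rightarrow> 'a \<Rightarrow> 'a"

(* The levels at infinity are the limits of the nested integer levels; without the equations
   for level T Pinf and level T Minf the two end levels would be unrelated to the others. *)
definition cover_tree :: "('a \<Rightarrow> 'a \<Rightarrow> real) \<Rightarrow> 'a set \<Rightarrow> 'a leveled_tree \<Rightarrow> bool" where
  "cover_tree d S T \<longleftrightarrow>
     (\<exists>root. level T Pinf = {root}) \<and>
     level T Minf = S \<and>
     level T Pinf = (\<Inter>i. level T (Fin i)) \<and>
     level T Minf = (\<Union>i. level T (Fin i)) \<and>
     (\<forall>i. level T (Fin i) \<subseteq> level T (Fin (i - 1))) \<and>
     (\<forall>i. \<forall>p \<in> level T (Fin (i - 1)).
        parent T i p \<in> level T (Fin i) \<and> d p (parent T i p) \<le> 2 powi i) \<and>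
     (\<forall>i. \<forall>p \<in> level T (Fin i). \<forall>q \<in> level T (Fin i). p \<noteq> q \<longrightarrow> d p q > 2 powi i)"

(* In a cover tree, r in level i is one of its own children: by separation no other point
   of level i is within distance 2 powi i of r. *)
definition children :: "'a leveled_tree \<Rightarrow> int \<Rightarrow> 'a \<Rightarrow> 'a set" where
  "children T i r = {p \<in> level T (Fin (i - 1)). parent T i p = r}"

definition max_kernel :: "('a \<Rightarrow> 'a \<Rightarrow> real) \<Rightarrow> 'a \<Rightarrow> 'a set \<Rightarrow> real" where
  "max_kernel K q R = Max (K q ` R)"

definition fastmks_step ::
  "('a \<Rightarrow> 'a \<Rightarrow> real) \<Rightarrow> 'a leveled_tree \<Rightarrow> 'a \<Rightarrow> int \<Rightarrow> 'a set \<Rightarrow> 'a set" where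
  "fastmks_step K T q i Ri =
     (let R = (\<Union>r\<in>Ri. children T i r)
      in {r \<in> R. K q r \<ge> max_kernel K q R - 2 powi i * sqrt (K q q)})"

(* The loop has no first and no last integer index. It leaves infinity at a finite level above
   which the candidate set is still the initial one, and it reaches minus infinity with the
   value at which the candidate sets become stationary. *)
definition fastmks_run ::
  "('a \<Rightarrow> 'a \<Rightarrow> real) \<Rightarrow> 'a leveled_tree \<Rightarrow> 'a \<Rightarrow> (int extended \<Rightarrow> 'a set) \<Rightarrow> bool" where
  "fastmks_run K T q R \<longleftrightarrow>
     R Pinf = level T Pinf \<and>
     (\<forall>\<^sub>F i in at_top. R (Fin i) = R Pinf) \<and>
     (\<forall>i. R (Fin (i - 1)) = fastmks_step K T q i (R (Fin i))) \<and>
     (\<forall>\<^sub>F i in at_bot. R (Fin i) = R Minf)"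

(* A relation, since the final arg max may have ties, which may be broken arbitrarily. *)
definition fastmks_returns ::
  "('a \<Rightarrow> 'a \<Rightarrow> real) \<Rightarrow> 'a leveled_tree \<Rightarrow> 'a \<Rightarrow> 'a \<Rightarrow> bool" where
  "fastmks_returns K T q x \<longleftrightarrow>
     (\<exists>R. fastmks_run K T q R \<and> is_arg_max (K q) (\<lambda>r. r \<in> R Minf) x)"

end

(* By Cauchy-Schwarz in the feature space, K q is Lipschitz with constant sqrt (K q q) for the
   kernel distance. Let p maximise K q over S. The ancestor r of p in level i - 1 is joined to p
   by parent steps of length at most 2 powi (i - 1), 2 powi (i - 2), ..., of total length at most
   2 powi i, so K q r is within 2 powi i * sqrt (K q q) of the maximum, and r is never pruned. *)
theory Submission imports Defs begin

section \<open>Cauchy--Schwarz for Mercer kernels\<close>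

text \<open>At \<open>(b, -a)\<close> and \<open>(-c, b)\<close> the form equals
  \<open>a * (a * c - b\<^sup>2)\<close> and \<open>c * (a * c - b\<^sup>2)\<close>, which settles
  the claim unless \<open>a = c = 0\<close>; in that case \<open>(b, -1)\<close> forces
  \<open>b = 0\<close>.\<close>

lemma discriminant_le_of_quadratic_form_nonneg:
  fixes a b c :: real
  assumes nonneg: "\<And>s t. 0 \<le> a * s\<^sup>2 + 2 * b * s * t + c * t\<^sup>2"
  shows "b\<^sup>2 \<le> a * c"
proof -
  have ac: "0 \<le> a" "0 \<le> c"
    using nonneg[of 1 0] nonneg[of 0 1] by simp_all
  have a_mult: "0 \<le> a * (a * c - b\<^sup>2)"
    using nonneg[of b "- a"] by (simp add: algebra_simps power2_eq_square)
  have c_mult: "0 \<le> c * (a * c - b\<^sup>2)"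
    using nonneg[of "- c" b] by (simp add: algebra_simps power2_eq_square)
  consider "a > 0" | "c > 0" | "a = 0" "c = 0"
    using ac by fastforce
  then show ?thesis
  proof cases
    case 1
    then show ?thesis using a_mult by (simp add: zero_le_mult_iff)
  next
    case 2
    then show ?thesis using c_mult by (simp add: zero_le_mult_iff)
  next
    case 3
    then show ?thesis
      using nonneg[of b "- 1"] by (simp add: power2_eq_square)
  qed
qed

text \<open>With a feature map \<phi>, this is the squared norm of s \<phi>(q) + t (\<phi>(p) -
  \<phi>(r)), expanded. Here it comes straight from positivity of the kernel sums.\<close>

lemma mercer_kernel_diff_form_nonneg:
  fixes s t :: real
  assumes K: "mercer_kernel X K" and X: "q \<in> X" "p \<in> X" "r \<in> X"
  shows "0 \<le> K q q * s\<^sup>2 + 2 * (K q p - K q r) * s * t + (K p p + K r r - 2 * K p r) * t\<^sup>2"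
proof -
  (* The weights add up when q coincides with p or r, so no case distinction is needed. *)
  define c where "c = (\<lambda>x. s * of_bool (x = q) + t * of_bool (x = p) - t * of_bool (x = r))"
  let ?F = "{q, p, r}"
  have delta: "(\<Sum>x\<in>F. of_bool (x = z) * g x) = g z" if "finite F" "z \<in> F"
    for F :: "'a set" and z and g :: "'a \<Rightarrow> real"
  proof -
    have "(\<Sum>x\<in>F. of_bool (x = z) * g x) = (\<Sum>x\<in>F. if x = z then g x else 0)"
      by (rule sum.cong) auto
    then show ?thesis
      using that by simp
  qed
  have pick: "(\<Sum>x\<in>?F. c x * g x) = s * g q + t * g p - t * g r" for g :: "'a \<Rightarrow> real"
  proof -
    have "(\<Sum>x\<in>?F. c x * g x) = s * (\<Sum>x\<in>?F. of_bool (x = q) * g x)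
        + t * (\<Sum>x\<in>?F. of_bool (x = p) * g x) - t * (\<Sum>x\<in>?F. of_bool (x = r) * g x)"
      unfolding c_def sum_distrib_left sum.distrib[symmetric] sum_subtractf[symmetric]
      by (rule sum.cong[OF refl]) (simp only: ring_distribs mult.assoc)
    also have "\<dots> = s * g q + t * g p - t * g r"
      by (simp only: delta finite.intros insertI1 insertI2)
    finally show ?thesis .
  qed
  have sym: "K p q = K q p" "K r q = K q r" "K r p = K p r"
    using K X by (auto simp: mercer_kernel_def)
  have "0 \<le> (\<Sum>x\<in>?F. \<Sum>y\<in>?F. c x * c y * K x y)"
    using K[unfolded mercer_kernel_def, THEN conjunct2, rule_format, of ?F c] X by simp
  \<comment> \<open>Factoring out \<open>c x\<close> lets \<open>pick\<close> evaluate first the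
    inner sum, then the outer one.\<close>
  also have "\<dots> = (\<Sum>x\<in>?F. c x * (\<Sum>y\<in>?F. c y * K x y))"
    by (simp only: sum_distrib_left mult.assoc)
  also have "\<dots> = K q q * s\<^sup>2 + 2 * (K q p - K q r) * s * t + (K p p + K r r - 2 * K p r) * t\<^sup>2"
    unfolding pick sym by (simp add: algebra_simps power2_eq_square)
  finally show ?thesis .
qed

lemma mercer_kernel_diag_nonneg:
  assumes "mercer_kernel X K" "q \<in> X"
  shows "0 \<le> K q q"
  using mercer_kernel_diff_form_nonneg[OF assms(1) assms(2) assms(2) assms(2), of 1 0] by simp

text \<open>Cauchy-Schwarz for the features of \<open>q\<close> and of the difference of
  \<open>p\<close> and \<open>r\<close>: the discriminant bound for the preceding form, whose last
  coefficient is the quantity under the root in \<open>kernel_dist\<close>.\<close>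

lemma mercer_kernel_lipschitz:
  assumes "mercer_kernel X K" "q \<in> X" "p \<in> X" "r \<in> X"
  shows "K q p - K q r \<le> sqrt (K q q) * kernel_dist K p r"
proof -
  have "(K q p - K q r)\<^sup>2 \<le> K q q * (K p p + K r r - 2 * K p r)"
    using mercer_kernel_diff_form_nonneg[OF assms]
    by (intro discriminant_le_of_quadratic_form_nonneg) auto
  then show ?thesis
    unfolding kernel_dist_def real_sqrt_mult[symmetric] by (rule real_le_rsqrt)
qed


section \<open>Levels of a cover tree\<close>

lemma
  assumes "cover_tree d S T"
  shows cover_tree_level_step: "level T (Fin i) \<subseteq> level T (Fin (i - 1))"
    and cover_tree_parent_in: "p \<in> level T (Fin (i - 1)) \<Longrightarrow> parent T i p \<in> level T (Fin i)"
    and cover_tree_parent_dist: "p \<in> level T (Fin (i - 1)) \<Longrightarrow> d p (parent T i p) \<le> 2 powi i"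
    and cover_tree_level_subset: "level T (Fin i) \<subseteq> S"
  using assms unfolding cover_tree_def by auto

lemma cover_tree_level_antimono:
  assumes "cover_tree d S T" "i \<le> j"
  shows "level T (Fin j) \<subseteq> level T (Fin i)"
  using \<open>i \<le> j\<close>
proof (induction j rule: int_ge_induct)
  case (step j)
  then show ?case
    using cover_tree_level_step[OF assms(1), of "j + 1"] by auto
qed simp

lemma cover_tree_parent_self:
  assumes "cover_tree d S T" "p \<in> level T (Fin i)"
  shows "parent T i p = p"
proof -
  have "p \<in> level T (Fin (i - 1))"
    using assms cover_tree_level_step by blast
  then have "parent T i p \<in> level T (Fin i)" "d p (parent T i p) \<le> 2 powi i"
    using assms(1) by (auto intro: cover_tree_parent_in cover_tree_parent_dist)
  then show ?thesis
    using assms unfolding cover_tree_def by (metis not_less)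
qed

text \<open>A point outside the intersection misses some level, hence all higher ones by nesting;
  finiteness of \<open>S\<close> gives a threshold common to all such points.\<close>

lemma cover_tree_eventually_level_top:
  assumes T: "cover_tree d S T" and "finite S"
  shows "\<forall>\<^sub>F i in at_top. level T (Fin i) = level T Pinf"
proof -
  have Inter: "level T Pinf = (\<Inter>i. level T (Fin i))"
    using T by (simp add: cover_tree_def)
  have "\<forall>\<^sub>F i in at_top. x \<notin> level T (Fin i)" if "x \<in> S - level T Pinf" for x
    using that cover_tree_level_antimono[OF T] unfolding Inter eventually_at_top_linorder by blast
  then have "\<forall>\<^sub>F i in at_top. \<forall>x\<in>S - level T Pinf. x \<notin> level T (Fin i)"
    using \<open>finite S\<close> by (auto intro: eventually_ball_finite)
  then show ?thesis
    by eventually_elim (use cover_tree_level_subset[OF T] Inter in blast)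
qed

lemma cover_tree_eventually_level_bot:
  assumes T: "cover_tree d S T" and "finite S"
  shows "\<forall>\<^sub>F i in at_bot. level T (Fin i) = S"
proof -
  have "level T Minf = S" "level T Minf = (\<Union>i. level T (Fin i))"
    using T unfolding cover_tree_def by blast+
  then have "S = (\<Union>i. level T (Fin i))"
    by (rule subst)
  then have "\<forall>\<^sub>F i in at_bot. x \<in> level T (Fin i)" if "x \<in> S" for x
    using that cover_tree_level_antimono[OF T] unfolding eventually_at_bot_linorder by blast
  then have "\<forall>\<^sub>F i in at_bot. \<forall>x\<in>S. x \<in> level T (Fin i)"
    using \<open>finite S\<close> by (auto intro: eventually_ball_finite)
  then show ?thesis
    by eventually_elim (use cover_tree_level_subset[OF T] in blast)
qed

lemma fastmks_step_subset_level: "fastmks_step K T q i R \<subseteq> level T (Fin (i - 1))"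
  by (auto simp: fastmks_step_def children_def)


section \<open>Runs exist\<close>

text \<open>Every point of the level is its own parent, so where two consecutive levels agree it has
  no child but itself. This controls the run at both ends of the tree.\<close>

lemma Union_children_of_stationary_level:
  assumes T: "cover_tree d S T" and eq: "level T (Fin (i - 1)) = level T (Fin i)"
    and "R \<subseteq> level T (Fin i)"
  shows "(\<Union>r\<in>R. children T i r) = R"
  using assms(3) cover_tree_parent_self[OF T, of _ i] unfolding children_def eq by auto

lemma decseq_finite_sets_eventually_const_at_bot:
  fixes F :: "int \<Rightarrow> 'a set"
  assumes dec: "\<forall>\<^sub>F i in at_bot. F (i - 1) \<subseteq> F i" and fin: "\<And>i. finite (F i)"
  shows "\<exists>B. \<forall>\<^sub>F i in at_bot. F i = B"
proof -
  obtain j where j: "\<And>i. i \<le> j \<Longrightarrow> F (i - 1) \<subseteq> F i"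
    using dec unfolding eventually_at_bot_linorder by blast
  have mono: "F i \<subseteq> F k" if "i \<le> k" "k \<le> j" for i k
    using that(1)
  proof (induction i rule: int_le_induct)
    case (step i)
    then show ?case using j[of i] that(2) by auto
  qed simp
  \<comment> \<open>A set of least cardinality in the decreasing range cannot shrink further, so the
    family is constant from \<open>k\<close> downwards.\<close>
  obtain k where k: "k \<le> j" "\<And>i. i \<le> j \<Longrightarrow> card (F k) \<le> card (F i)"
    using ex_has_least_nat[of "\<lambda>i. i \<le> j" j "\<lambda>i. card (F i)"] by auto
  have "F i = F k" if "i \<le> k" for i
    using card_seteq[OF fin mono[OF that k(1)]] k that by auto
  then show ?thesis
    unfolding eventually_at_bot_linorder by blast
qed

text \<open>A run is specified by relations between all integer levels, so one has to be built:
  recursion downwards from a level where only the root is left, constant above it, and a stationary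
  limit below.\<close>

lemma fastmks_run_exists:
  assumes T: "cover_tree d S T" and "finite S" and "0 \<le> K q q"
  shows "\<exists>R. fastmks_run K T q R"
proof -
  obtain root where root: "level T Pinf = {root}"
    using T unfolding cover_tree_def by blast
  obtain i0 where i0: "\<And>i. i \<ge> i0 \<Longrightarrow> level T (Fin i) = {root}"
    using cover_tree_eventually_level_top[OF T \<open>finite S\<close>]
    unfolding root eventually_at_top_linorder by blast
  define f where "f = rec_nat {root} (\<lambda>n. fastmks_step K T q (i0 - int n))"
  \<comment> \<open>\<open>f\<close> counts steps down from \<open>i0\<close>; \<open>nat\<close>
    truncates to 0 above \<open>i0\<close>, which gives the constant value \<open>{root}\<close>
    there.\<close>
  define F where "F i = f (nat (i0 - i))" for i
  have F_top: "F i = {root}" if "i \<ge> i0" for i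
    using that by (simp add: F_def f_def)
  have F_step: "F (i - 1) = fastmks_step K T q i (F i)" for i
  proof (cases "i \<le> i0")
    case True
    then have "nat (i0 - (i - 1)) = Suc (nat (i0 - i))" "i0 - int (nat (i0 - i)) = i"
      by auto
    then show ?thesis
      by (simp add: F_def f_def)
  next
    case False
    \<comment> \<open>Now \<open>i - 1\<close> is still at least \<open>i0\<close>, so both levels
      are \<open>{root}\<close>; the root survives because the pruning slack is nonnegative.\<close>
    have "(\<Union>r\<in>{root}. children T i r) = {root}"
      by (rule Union_children_of_stationary_level[OF T]) (use False i0 in auto)
    then show ?thesis
      using False \<open>0 \<le> K q q\<close> by (auto simp: F_top fastmks_step_def max_kernel_def)
  qed
  have F_level: "F i \<subseteq> level T (Fin i)" for i
    using F_step[of "i + 1"] fastmks_step_subset_level[of K T q "i + 1"] by simp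
  have "\<forall>\<^sub>F i in at_bot. F (i - 1) \<subseteq> F i"
  proof -
    obtain j where j: "\<And>i. i \<le> j \<Longrightarrow> level T (Fin i) = S"
      using cover_tree_eventually_level_bot[OF T \<open>finite S\<close>]
      unfolding eventually_at_bot_linorder by blast
    have "F (i - 1) \<subseteq> F i" if "i \<le> j" for i
    proof -
      \<comment> \<open>Once the levels equal \<open>S\<close>, descending adds no candidates and
        pruning can only remove some.\<close>
      have "(\<Union>r\<in>F i. children T i r) = F i"
        by (rule Union_children_of_stationary_level[OF T]) (use j that F_level in auto)
      then show ?thesis
        unfolding F_step by (auto simp: fastmks_step_def Let_def)
    qed
    then show ?thesis
      unfolding eventually_at_bot_linorder by blast
  qed
  moreover have "finite (F i)" for i
    using F_level cover_tree_level_subset[OF T] \<open>finite S\<close> by (meson finite_subset)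
  ultimately obtain B where B: "\<forall>\<^sub>F i in at_bot. F i = B"
    using decseq_finite_sets_eventually_const_at_bot by blast
  define R where "R = case_extended F {root} B"
  have "fastmks_run K T q R"
    unfolding fastmks_run_def R_def using F_top F_step B root
    by (auto simp: eventually_at_top_linorder)
  then show ?thesis
    by blast
qed


section \<open>Maximisers are never pruned\<close>

lemma fastmks_run_subset_level:
  assumes "fastmks_run K T q R"
  shows "R (Fin i) \<subseteq> level T (Fin i)"
proof -
  have "R (Fin (i + 1 - 1)) = fastmks_step K T q (i + 1) (R (Fin (i + 1)))"
    using assms unfolding fastmks_run_def by blast
  then show ?thesis
    using fastmks_step_subset_level[of K T q "i + 1"] by simp
qed

text \<open>For \<open>p\<close> in level \<open>j\<close>, the ancestor \<open>n\<close>
  generations up lies in level \<open>j + n\<close>; the index has \<open>+ 1\<close> because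
  \<open>parent T i\<close> acts on level \<open>i - 1\<close>.\<close>

primrec ancestor :: "'a leveled_tree \<Rightarrow> int \<Rightarrow> 'a \<Rightarrow> nat \<Rightarrow> 'a" where
  "ancestor T j p 0 = p"
| "ancestor T j p (Suc n) = parent T (j + int n + 1) (ancestor T j p n)"

lemma ancestor_in_level:
  assumes T: "cover_tree d S T" and "p \<in> level T (Fin j)"
  shows "ancestor T j p n \<in> level T (Fin (j + int n))"
proof (induction n)
  case (Suc n)
  then show ?case
    using cover_tree_parent_in[OF T, of "ancestor T j p n" "j + int n + 1"]
    by (simp add: algebra_simps)
qed (use assms in simp)

text \<open>By the Lipschitz bound, the loss is at most \<open>sqrt (K q q)\<close> times the length
  of the parent path. The bound is exactly the pruning slack of the step that produces level
  \<open>j + n\<close>.\<close>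

lemma kernel_ancestor_ge:
  assumes K: "mercer_kernel X K" and T: "cover_tree (kernel_dist K) S T"
    and "S \<subseteq> X" "q \<in> X" and p: "p \<in> level T (Fin j)"
  shows "K q p - 2 powi (j + int n + 1) * sqrt (K q q) \<le> K q (ancestor T j p n)"
proof -
  (* The strengthening by 2 powi (j + 1) makes the geometric sum telescope. *)
  have "K q p - (2 powi (j + int n + 1) - 2 powi (j + 1)) * sqrt (K q q) \<le> K q (ancestor T j p n)"
  proof (induction n)
    case (Suc n)
    let ?a = "ancestor T j p n" and ?b = "ancestor T j p (Suc n)" and ?i = "j + int n + 1"
    have a: "?a \<in> level T (Fin (?i - 1))"
      using ancestor_in_level[OF T p, of n] by simp
    have "?a \<in> X" "?b \<in> X"
      using ancestor_in_level[OF T p] cover_tree_level_subset[OF T] \<open>S \<subseteq> X\<close> by blast+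
    then have "K q ?a - K q ?b \<le> sqrt (K q q) * kernel_dist K ?a ?b"
      using K \<open>q \<in> X\<close> by (intro mercer_kernel_lipschitz)
    also have "\<dots> \<le> sqrt (K q q) * 2 powi ?i"
      using cover_tree_parent_dist[OF T a] mercer_kernel_diag_nonneg[OF K \<open>q \<in> X\<close>]
      by (intro mult_left_mono) auto
    finally have "K q ?a - K q ?b \<le> sqrt (K q q) * 2 powi ?i" .
    \<comment> \<open>The new loss \<open>2 powi ?i\<close> doubles the leading term of the
      accumulated one, which preserves the telescoped form.\<close>
    moreover have "j + int (Suc n) + 1 = ?i + 1"
      by simp
    then have "(2::real) powi (j + int (Suc n) + 1) = 2 * 2 powi ?i"
      by (simp only: power_int_add_1'[of "2::real"] zero_neq_numeral[symmetric] not_False_eq_True simp_thms)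
    ultimately show ?case
      using Suc.IH by (simp add: algebra_simps)
  qed simp
  moreover have "0 \<le> 2 powi (j + 1) * sqrt (K q q)"
    using mercer_kernel_diag_nonneg[OF K \<open>q \<in> X\<close>] by simp
  ultimately show ?thesis
    by (simp add: algebra_simps)
qed

text \<open>Induction down the tree: high up, the candidates fill the whole level; below, a
  surviving parent makes its child a candidate, and the child is close enough to the maximum to be
  kept.\<close>

lemma ancestor_in_fastmks_run:
  assumes K: "mercer_kernel X K" and T: "cover_tree (kernel_dist K) S T"
    and "finite S" "S \<subseteq> X" "q \<in> X" and R: "fastmks_run K T q R"
    and p: "p \<in> level T (Fin j)" and max: "\<And>r. r \<in> S \<Longrightarrow> K q r \<le> K q p"
  shows "ancestor T j p n \<in> R (Fin (j + int n))"
proof -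
  have "\<forall>\<^sub>F i in at_top. R (Fin i) = level T (Fin i)"
    using cover_tree_eventually_level_top[OF T \<open>finite S\<close>] R
    unfolding fastmks_run_def by (auto elim: eventually_elim2)
  then obtain i0 where i0: "\<And>i. i \<ge> i0 \<Longrightarrow> R (Fin i) = level T (Fin i)"
    unfolding eventually_at_top_linorder by blast
  have top: "ancestor T j p m \<in> R (Fin (j + int m))" if "m \<ge> nat (i0 - j)" for m
    using that i0[of "j + int m"] ancestor_in_level[OF T p, of m] by auto
  have step_down: "ancestor T j p m \<in> R (Fin (j + int m))"
    if Suc: "ancestor T j p (Suc m) \<in> R (Fin (j + int (Suc m)))" for m
  proof -
    let ?i = "j + int m + 1" and ?a = "ancestor T j p m"
    let ?C = "\<Union>r\<in>R (Fin ?i). children T ?i r"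
    have a: "?a \<in> ?C"
      using Suc ancestor_in_level[OF T p, of m] by (auto simp: children_def algebra_simps)
    have "?C \<subseteq> S"
      using cover_tree_level_subset[OF T] by (auto simp: children_def)
    \<comment> \<open>The candidates lie in \<open>S\<close>, so \<open>K q p\<close> caps the
      maximum in the pruning threshold, and comparing \<open>?a\<close> with \<open>p\<close>
      suffices.\<close>
    then have "max_kernel K q ?C \<le> K q p"
      using a max finite_subset[OF _ \<open>finite S\<close>] unfolding max_kernel_def
      by (intro Max.boundedI) auto
    then have "max_kernel K q ?C - 2 powi ?i * sqrt (K q q) \<le> K q ?a"
      using kernel_ancestor_ge[OF K T \<open>S \<subseteq> X\<close> \<open>q \<in> X\<close> p, of m] by linarith
    then have "?a \<in> fastmks_step K T q ?i (R (Fin ?i))"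
      using a by (simp add: fastmks_step_def Let_def)
    also have "\<dots> = R (Fin (?i - 1))"
      using R unfolding fastmks_run_def by metis
    finally show ?thesis
      by simp
  qed
  show ?thesis
  proof (cases "n \<le> nat (i0 - j)")
    case True
    then show ?thesis
    \<comment> \<open>The induction lowers the generation from \<open>nat (i0 - j)\<close>, where
      the level is still unpruned, to \<open>n\<close>.\<close>
    proof (induction rule: inc_induct)
      case base
      show ?case by (rule top) simp
    next
      case (step m)
      show ?case by (rule step_down) (rule step.IH)
    qed
  next
    case False
    then show ?thesis by (intro top) simp
  qed
qed

lemma fastmks_run_result:
  assumes K: "mercer_kernel X K" and T: "cover_tree (kernel_dist K) S T"
    and "finite S" "S \<subseteq> X" "q \<in> X" and R: "fastmks_run K T q R"
  shows "R Minf \<subseteq> S"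
    and "\<lbrakk>p \<in> S; \<And>r. r \<in> S \<Longrightarrow> K q r \<le> K q p\<rbrakk> \<Longrightarrow> p \<in> R Minf"
proof -
  have "\<forall>\<^sub>F i in at_bot. R (Fin i) = R Minf"
    using R by (simp add: fastmks_run_def)
  with cover_tree_eventually_level_bot[OF T \<open>finite S\<close>]
  have "\<forall>\<^sub>F i in at_bot. level T (Fin i) = S \<and> R (Fin i) = R Minf"
    by (rule eventually_conj)
  then obtain j where j: "level T (Fin j) = S" "R (Fin j) = R Minf"
    unfolding eventually_at_bot_linorder by blast
  show "R Minf \<subseteq> S"
    using fastmks_run_subset_level[OF R, of j] j by simp
  show "p \<in> R Minf" if "p \<in> S" "\<And>r. r \<in> S \<Longrightarrow> K q r \<le> K q p"
    \<comment> \<open>Level \<open>j\<close> is all of \<open>S\<close>, so \<open>p\<close> starts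
      there and is its own ancestor of generation 0.\<close>
    using ancestor_in_fastmks_run[OF assms, of p j 0] that j by simp
qed

text \<open>The existence part keeps the claim about all returned points from being vacuous.\<close>

theorem theorem4p3:
  fixes X S :: "'a set" and K :: "'a \<Rightarrow> 'a \<Rightarrow> real" and T :: "'a leveled_tree" and q :: 'a
  assumes "mercer_kernel X K"
    and "finite S" and "S \<subseteq> X"
    and "cover_tree (kernel_dist K) S T"
    and "q \<in> X"
  shows "(\<exists>x. fastmks_returns K T q x) \<and>
         (\<forall>x. fastmks_returns K T q x \<longrightarrow> is_arg_max (K q) (\<lambda>r. r \<in> S) x)"
proof -
  have "S \<noteq> {}"
    using assms(4) unfolding cover_tree_def by blast
  then have "Max (K q ` S) \<in> K q ` S"
    using \<open>finite S\<close> by simp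
  then obtain p where "p \<in> S" and "Max (K q ` S) = K q p"
    by blast
  then have p: "p \<in> S" "\<And>r. r \<in> S \<Longrightarrow> K q r \<le> K q p"
    using \<open>finite S\<close> by (auto simp flip: \<open>Max (K q ` S) = K q p\<close>)
  note result = fastmks_run_result[OF assms(1,4,2,3,5)]
  obtain R where R: "fastmks_run K T q R"
    using fastmks_run_exists[OF assms(4,2)] mercer_kernel_diag_nonneg[OF assms(1,5)] by blast
  have "is_arg_max (K q) (\<lambda>r. r \<in> R Minf) p"
    using result[OF R] p unfolding is_arg_max_linorder by blast
  then have "fastmks_returns K T q p"
    using R unfolding fastmks_returns_def by blast
  moreover have "is_arg_max (K q) (\<lambda>r. r \<in> S) x" if x: "fastmks_returns K T q x" for x
  proof -
    obtain R' where R': "fastmks_run K T q R'" "is_arg_max (K q) (\<lambda>r. r \<in> R' Minf) x"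
      using x unfolding fastmks_returns_def by blast
    \<comment> \<open>The maximiser \<open>p\<close> over \<open>S\<close> survives this run too, so
      \<open>x\<close> was compared with it.\<close>
    then have "x \<in> S" "K q p \<le> K q x"
      using result[OF R'(1)] p unfolding is_arg_max_linorder by blast+
    then show ?thesis
      using p unfolding is_arg_max_linorder by (meson order_trans)
  qed
  ultimately show ?thesis
    by blast
qed

end
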